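(* Let $n\ge2$ and $m,l\ge2$ be integers, $\Lambda=(\mathcal A^{(1)},\ldots,\mathcal A^{(m-1)})\in\mathcal F_{m,n}$ and $\Theta=(\mathcal B^{(1)},\ldots,\mathcal B^{(l-1)})\in\mathcal F_{l,n}$. Suppose that the leading tensor pair $(\mathcal A^{(1)},\mathcal B^{(1)})$ in $(\Lambda,\Theta)$ is an $\mathbf{ER}$-tensor pair. Suppose that either (a) $m=l$, or (b) $m\neq l$ and the one of $\mathcal A^{(1)}$ (of order $m$) and $\mathcal B^{(1)}$ (of order $l$) whose order is larger has even order and is positive definite. For $\boldsymbol a,\boldsymbol b\in\mathbb R^n$ put $F(\boldsymbol x):=\sum_{k=1}^{m-1}\mathcal A^{(k)}\boldsymbol x^{m-k}+\boldsymbol a$, $G(\boldsymbol x):=\sum_{p=1}^{l-1}\mathcal B^{(p)}\boldsymbol x^{l-p}+\boldsymbol b$, and let $\Omega$ be the solution set of $\mathrm{GPCP}(\Lambda,\boldsymbol a,\Theta,\boldsymbol b)$. Then for any $\boldsymbol a,\boldsymbol b\in\mathbb R^n$ such that the following condition holds: for any sequence $\{\boldsymbol x^{(i)}\}$ in $\mathbb R^n$ with $\boldsymbol x^{(i)}\to\bar{\boldsymbol x}\in\Omega$ as $i\to\infty$ and $\boldsymbol x^{(i)}\neq\bar{\boldsymbol x}$, there exist a subsequence $\{\boldsymbol x^{(i_j)}\}$ of $\{\boldsymbol x^{(i)}\}$ and an index $j_0\in\{1,\ldots,n\}$ such that $$\lim_{i_j\to\infty}\frac{\min\{F_{j_0}(\boldsymbol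 x^{(i_j)}),G_{j_0}(\boldsymbol x^{(i_j)})\}}{\|\boldsymbol x^{(i_j)}-\bar{\boldsymbol x}\|}\neq0,$$ the function $r(\boldsymbol x):=\|\min\{F(\boldsymbol x),G(\boldsymbol x)\}\|$ is a global Lipschitzian error bound for $\mathrm{GPCP}(\Lambda,\boldsymbol a,\Theta,\boldsymbol b)$, i.e. there exists a constant $c>0$ such that $\mathrm{dist}(\boldsymbol x,\Omega)\le c\,r(\boldsymbol x)$ for all $\boldsymbol x\in\mathbb R^n$.
   Context: $\mathbb T_{m,n}$ is the space of real $m$-th order $n$-dimensional square tensors $\mathcal A=(a_{j_1\ldots j_m})$, $1\le j_1,\ldots,j_m\le n$, and $\mathcal F_{m,n}:=\mathbb T_{m,n}\times\mathbb T_{m-1,n}\times\cdots\times\mathbb T_{2,n}$, so $\mathcal A^{(k)}\in\mathbb T_{m-k+1,n}$, $\mathcal B^{(p)}\in\mathbb T_{l-p+1,n}$. For $\mathcal A\in\mathbb T_{m,n}$ and $\boldsymbol x\in\mathbb R^n$, $\mathcal A\boldsymbol x^{m-1}\in\mathbb R^n$ has $j$-th component $\sum_{j_2,\ldots,j_m=1}^n a_{jj_2\ldots j_m}x_{j_2}\cdots x_{j_m}$, and $\mathcal A\boldsymbol x^m:=\langle\boldsymbol x,\mathcal A\boldsymbol x^{m-1}\rangle$. A tensor $\mathcal A\in\mathbb T_{m,n}$ of even order $m$ is positive definite if $\mathcal A\boldsymbol x^m>0$ for all $\boldsymbol x\in\mathbb R^n\setminus\{\boldsymbol 0\}$. A pair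 $(\mathcal A,\mathcal B)\in\mathbb T_{m,n}\times\mathbb T_{l,n}$ is an $\mathbf{ER}$-tensor pair if there exists no $(\boldsymbol x,v,t)\in(\mathbb R^n\setminus\{\boldsymbol 0\})\times\mathbb R_+\times\mathbb R_+$ such that $\mathcal A\boldsymbol x^{m-1}+v\boldsymbol x\in\mathbb R^n_+$, $\mathcal B\boldsymbol x^{l-1}+t\boldsymbol x\in\mathbb R^n_+$ and $\langle\mathcal A\boldsymbol x^{m-1}+v\boldsymbol x,\mathcal B\boldsymbol x^{l-1}+t\boldsymbol x\rangle=0$. $\mathrm{GPCP}(\Lambda,\boldsymbol a,\Theta,\boldsymbol b)$ is the problem of finding $\boldsymbol x\in\mathbb R^n$ with $F(\boldsymbol x)\in\mathbb R^n_+$, $G(\boldsymbol x)\in\mathbb R^n_+$ and $\langle F(\boldsymbol x),G(\boldsymbol x)\rangle=0$; $\Omega$ is the set of all such $\boldsymbol x$. $F_j$ denotes the $j$-th component of $F$; $\min\{F(\boldsymbol x),G(\boldsymbol x)\}$ is the componentwise minimum; $\|\cdot\|$ is the Euclidean norm; $\mathrm{dist}(\boldsymbol x,\Omega)$ is the Euclidean distance from $\boldsymbol x$ to $\Omega$. "$\lim\neq0$" means that the quotient does not converge to $0$ along the subsequence. *)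

theory Defs
  imports "HOL-Analysis.Analysis" "HOL-Library.FuncSet"
begin

text \<open>
  The dimension n is \<open>CARD('n)\<close>. A tensor of order \<open>m\<close> maps index lists
  \<open>[j\<^sub>1, \<dots>, j\<^sub>m]\<close> to its entries, so that the order may vary inside a formula.
\<close>

type_synonym 'n tensor = "'n list \<Rightarrow> real"

definition tensors :: "nat \<Rightarrow> 'n::finite tensor set" where
  "tensors m = {js. length js = m} \<rightarrow>\<^sub>E UNIV"

definition tensor_tuples :: "nat \<Rightarrow> (nat \<Rightarrow> 'n::finite tensor) set" where
  "tensor_tuples m = (\<Pi>\<^sub>E k\<in>{1..m - 1}. tensors (m - k + 1))"

text \<open>\<open>tensor_apply m A x\<close> is the vector \<open>A x\<^bsup>m-1\<^esup>\<close>, and \<open>tensor_form m A x\<close> is the number \<open>A x\<^bsup>m\<^esup>\<close>.\<close>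

definition tensor_apply :: "nat \<Rightarrow> 'n::finite tensor \<Rightarrow> real ^ 'n \<Rightarrow> real ^ 'n" where
  "tensor_apply m A x =
     (\<chi> j. \<Sum>js\<in>{js. length js = m - 1}. A (j # js) * (\<Prod>i\<leftarrow>js. x $ i))"

definition tensor_form :: "nat \<Rightarrow> 'n::finite tensor \<Rightarrow> real ^ 'n \<Rightarrow> real" where
  "tensor_form m A x = x \<bullet> tensor_apply m A x"

definition positive_definite_tensor :: "nat \<Rightarrow> 'n::finite tensor \<Rightarrow> bool" where
  "positive_definite_tensor m A \<longleftrightarrow> even m \<and> (\<forall>x. x \<noteq> 0 \<longrightarrow> tensor_form m A x > 0)"

text \<open>
  The order on \<open>real ^ 'n\<close> is componentwise, so \<open>0 \<le> y\<close> says that \<open>y\<close> lies in the closed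
  nonnegative orthant.
\<close>

definition complementary :: "real ^ 'n::finite \<Rightarrow> real ^ 'n \<Rightarrow> bool" where
  "complementary y z \<longleftrightarrow> 0 \<le> y \<and> 0 \<le> z \<and> y \<bullet> z = 0"

definition ER_tensor_pair :: "nat \<Rightarrow> 'n::finite tensor \<Rightarrow> nat \<Rightarrow> 'n tensor \<Rightarrow> bool" where
  "ER_tensor_pair m A l B \<longleftrightarrow>
     \<not> (\<exists>(x :: real ^ 'n) (v :: real) (t :: real). x \<noteq> 0 \<and> v \<ge> 0 \<and> t \<ge> 0 \<and>
           complementary (tensor_apply m A x + v *\<^sub>R x) (tensor_apply l B x + t *\<^sub>R x))"

definition tensor_poly ::
    "nat \<Rightarrow> (nat \<Rightarrow> 'n::finite tensor) \<Rightarrow> real ^ 'n \<Rightarrow> real ^ 'n \<Rightarrow> real ^ 'n" where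
  "tensor_poly m \<A> a x = (\<Sum>k=1..m - 1. tensor_apply (m - k + 1) (\<A> k) x) + a"

definition GPCP_solutions :: "(real ^ 'n::finite \<Rightarrow> real ^ 'n) \<Rightarrow> (real ^ 'n \<Rightarrow> real ^ 'n) \<Rightarrow> (real ^ 'n) set" where
  "GPCP_solutions F G = {x. complementary (F x) (G x)}"

definition natural_residual ::
    "(real ^ 'n::finite \<Rightarrow> real ^ 'n) \<Rightarrow> (real ^ 'n \<Rightarrow> real ^ 'n) \<Rightarrow> real ^ 'n \<Rightarrow> real" where
  "natural_residual F G x = norm (\<chi> j. min (F x $ j) (G x $ j))"

text \<open>
  \<open>infdist x {} = 0\<close> in the library, whereas the distance to the empty set (an infimum over
  no points) is infinite and admits no error bound; hence the conjunct \<open>\<Omega> \<noteq> {}\<close>.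
\<close>

definition global_Lipschitz_error_bound ::
    "(real ^ 'n::finite \<Rightarrow> real) \<Rightarrow> (real ^ 'n) set \<Rightarrow> bool" where
  "global_Lipschitz_error_bound r \<Omega> \<longleftrightarrow>
     \<Omega> \<noteq> {} \<and> (\<exists>c>0. \<forall>x. infdist x \<Omega> \<le> c * r x)"

end

theory Submission
  imports Defs
begin

text \<open>
  The solutions are the zeros of \<open>f x = min (F x) (G x)\<close>. If \<open>norm (x k)\<close> tends to infinity and
  \<open>f (x k) + \<mu> k *\<^sub>R x k = o (norm (x k))\<close> with \<open>\<mu> k \<ge> 0\<close>, then a limit of the normalised points
  contradicts the ER property or, when the multiplier dominates the map of smaller degree only,
  positive definiteness of the other leading tensor. For the multipliers produced by Brouwer's theorem on
  large balls this gives a solution; for \<open>\<mu> = 0\<close> it says that the residual grows at least linearly at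
  infinity. On bounded sets, a sequence violating the error bound accumulates at a solution, against
  the local condition.
\<close>

section \<open>Complementarity as a system of equations in the componentwise minimum\<close>

lemma complementary_iff_min:
  "complementary y z \<longleftrightarrow> (\<forall>j. min (y $ j) (z $ j) = 0)"
proof
  assume c: "complementary y z"
  then have nn: "0 \<le> y $ j" "0 \<le> z $ j" for j
    by (auto simp: complementary_def less_eq_vec_def)
  from c have "(\<Sum>j\<in>UNIV. y $ j * z $ j) = 0"
    by (simp add: complementary_def inner_vec_def)
  then have "y $ j * z $ j = 0" for j
    using nn by (subst (asm) sum_nonneg_eq_0_iff) auto
  then have "y $ j = 0 \<or> z $ j = 0" for j
    by (simp only: mult_eq_0_iff)
  then have "min (y $ j) (z $ j) = 0" for j
    using nn[of j] by (metis min.absorb1 min.absorb2)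
  then show "\<forall>j. min (y $ j) (z $ j) = 0"
    by blast
next
  assume m: "\<forall>j. min (y $ j) (z $ j) = 0"
  have "0 \<le> y $ j \<and> 0 \<le> z $ j \<and> (y $ j = 0 \<or> z $ j = 0)" for j
    using m[rule_format, of j] by (auto simp: min_def split: if_splits)
  then have "0 \<le> y" "0 \<le> z" "\<forall>j. y $ j * z $ j = 0"
    by (simp_all add: less_eq_vec_def)
  then show "complementary y z"
    by (auto simp: complementary_def inner_vec_def intro!: sum.neutral)
qed

lemma complementary_commute: "complementary y z \<longleftrightarrow> complementary z y"
  by (simp add: complementary_iff_min min.commute)

text \<open>The two factors may differ, so each map can later be normalised by its own degree and
  multiplier.\<close>

lemma complementary_scaleR:
  assumes "complementary y z" "0 \<le> \<alpha>" "0 \<le> \<beta>"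
  shows "complementary (\<alpha> *\<^sub>R y) (\<beta> *\<^sub>R z)"
  using assms by (auto simp: complementary_def less_eq_vec_def)

text \<open>Closedness holds because complementarity is a system of equations in the continuous
  function \<open>min\<close>.\<close>

lemma complementary_tendsto:
  assumes "(y \<longlongrightarrow> y0) Fl" "(z \<longlongrightarrow> z0) Fl" "Fl \<noteq> bot"
    and "eventually (\<lambda>k. complementary (y k) (z k)) Fl"
  shows "complementary y0 z0"
  unfolding complementary_iff_min
proof
  fix j
  have "((\<lambda>k. min (y k $ j) (z k $ j)) \<longlongrightarrow> min (y0 $ j) (z0 $ j)) Fl"
    by (intro tendsto_intros assms)
  moreover have "eventually (\<lambda>k. min (y k $ j) (z k $ j) = 0) Fl"
    using assms(4) by eventually_elim (simp add: complementary_iff_min)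
  ultimately show "min (y0 $ j) (z0 $ j) = 0"
    using tendsto_unique[OF assms(3) _ tendsto_eventually] by blast
qed

section \<open>Tensor maps: continuity, homogeneity and behaviour at infinity\<close>

lemma tendsto_tensor_apply:
  fixes x0 :: "real ^ 'n::finite"
  assumes "(x \<longlongrightarrow> x0) Fl"
  shows "((\<lambda>k. tensor_apply m A (x k)) \<longlongrightarrow> tensor_apply m A x0) Fl"
proof -
  have "((\<lambda>k. \<Prod>i\<leftarrow>js. x k $ i) \<longlongrightarrow> (\<Prod>i\<leftarrow>js. x0 $ i)) Fl" for js :: "'n list"
    by (induction js) (auto intro!: tendsto_intros assms)
  then show ?thesis
    unfolding tensor_apply_def by (intro tendsto_intros)
qed

lemma tensor_apply_scaleR:
  fixes x :: "real ^ 'n::finite"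
  shows "tensor_apply m A (r *\<^sub>R x) = r ^ (m - 1) *\<^sub>R tensor_apply m A x"
proof -
  have "(\<Prod>i\<leftarrow>js. (r *\<^sub>R x) $ i) = r ^ length js * (\<Prod>i\<leftarrow>js. x $ i)" for js :: "'n list"
    by (induction js) (auto simp: algebra_simps)
  then show ?thesis
    by (simp add: tensor_apply_def vec_eq_iff sum_distrib_left algebra_simps)
qed

lemma continuous_on_tensor_poly: "continuous_on S (tensor_poly m \<A> a)"
  unfolding tensor_poly_def continuous_on_def
  by (intro ballI tendsto_add tendsto_sum tendsto_const tendsto_tensor_apply tendsto_ident_at)

text \<open>After division by the top power of \<open>r\<close>, the summand of index
  \<open>i\<close> carries the factor \<open>(1 / r) ^ (i - 1)\<close> and the constant carries
  \<open>(1 / r) ^ (m - 1)\<close>, so only the leading tensor survives.\<close>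

lemma tensor_poly_leading_term:
  fixes r :: "nat \<Rightarrow> real"
  assumes "m \<ge> 2" "filterlim r at_top sequentially" "u \<longlonglongrightarrow> u0" "\<And>k. r k > 0"
  shows "(\<lambda>k. inverse (r k ^ (m - 1)) *\<^sub>R tensor_poly m \<A> a (r k *\<^sub>R u k))
           \<longlonglongrightarrow> tensor_apply m (\<A> 1) u0"
proof -
  define \<epsilon> where "\<epsilon> k = inverse (r k)" for k
  have \<epsilon>: "\<epsilon> \<longlonglongrightarrow> 0"
    unfolding \<epsilon>_def by (rule tendsto_inverse_0_at_top[OF assms(2)])
  have "(\<lambda>k. (\<Sum>i=1..m - 1. \<epsilon> k ^ (i - 1) *\<^sub>R tensor_apply (m - i + 1) (\<A> i) (u k))
            + \<epsilon> k ^ (m - 1) *\<^sub>R a)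
        \<longlonglongrightarrow> (\<Sum>i=1..m - 1. 0 ^ (i - 1) *\<^sub>R tensor_apply (m - i + 1) (\<A> i) u0)
            + 0 ^ (m - 1) *\<^sub>R a"
    by (intro tendsto_intros tendsto_tensor_apply assms \<epsilon>)
  \<comment> \<open>The convention \<open>0 ^ 0 = 1\<close> singles out the summand
    \<open>i = 1\<close>.\<close>
  also have "(\<Sum>i=1..m - 1. (0::real) ^ (i - 1) *\<^sub>R tensor_apply (m - i + 1) (\<A> i) u0)
      = (\<Sum>i\<in>{1..m - 1}. if i = 1 then tensor_apply m (\<A> 1) u0 else 0)"
    using assms(1) by (intro sum.cong) auto
  also have "\<dots> = tensor_apply m (\<A> 1) u0"
    using assms(1) by simp
  also have "tensor_apply m (\<A> 1) u0 + 0 ^ (m - 1) *\<^sub>R a = tensor_apply m (\<A> 1) u0"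
    using assms(1) by simp
  also have "(\<lambda>k. (\<Sum>i=1..m - 1. \<epsilon> k ^ (i - 1) *\<^sub>R tensor_apply (m - i + 1) (\<A> i) (u k))
            + \<epsilon> k ^ (m - 1) *\<^sub>R a)
        = (\<lambda>k. inverse (r k ^ (m - 1)) *\<^sub>R tensor_poly m \<A> a (r k *\<^sub>R u k))"
  proof
    fix k
    have "\<epsilon> k ^ (i - 1) = inverse (r k ^ (m - 1)) * r k ^ (m - i)" if "i \<in> {1..m - 1}" for i
    proof -
      have "m - 1 = (i - 1) + (m - i)"
        using that by auto
      then have "r k ^ (m - 1) = r k ^ (i - 1) * r k ^ (m - i)"
        by (metis power_add)
      then show ?thesis
        using assms(4)[of k] by (simp add: \<epsilon>_def power_inverse)
    qed
    then show "(\<Sum>i=1..m - 1. \<epsilon> k ^ (i - 1) *\<^sub>R tensor_apply (m - i + 1) (\<A> i) (u k))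
            + \<epsilon> k ^ (m - 1) *\<^sub>R a
        = inverse (r k ^ (m - 1)) *\<^sub>R tensor_poly m \<A> a (r k *\<^sub>R u k)"
      by (simp add: tensor_poly_def tensor_apply_scaleR scaleR_add_right scaleR_sum_right
          \<epsilon>_def power_inverse)
  qed
  finally show ?thesis .
qed

section \<open>Zeros and multipliers from Brouwer's theorem\<close>

text \<open>A variant of the Leray--Schauder alternative.\<close>

lemma Brouwer_zero_or_multiplier:
  fixes f :: "'a::euclidean_space \<Rightarrow> 'a"
  assumes "continuous_on UNIV f" "R > 0"
  obtains x \<mu> where "\<mu> \<ge> 0" "f x + \<mu> *\<^sub>R x = 0" "f x = 0 \<or> norm x = R"
proof -
  \<comment> \<open>Scaling \<open>x - f x\<close> by \<open>s x\<close> is the radial projection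
    onto the ball of radius \<open>R\<close>; the \<open>max\<close> makes it continuous and keeps
    the denominator positive.\<close>
  define s where "s x = R / max R (norm (x - f x))" for x
  have s: "0 < s x" "s x \<le> 1" for x
    using assms(2) by (auto simp: s_def field_simps less_max_iff_disj)
  have "continuous_on (cball 0 R) (\<lambda>x. s x *\<^sub>R (x - f x))"
    unfolding s_def using assms(2)
    by (intro continuous_intros continuous_on_subset[OF assms(1)]) auto
  moreover have "norm (s x *\<^sub>R (x - f x)) \<le> R" for x
  proof -
    have "norm (s x *\<^sub>R (x - f x)) = R * (norm (x - f x) / max R (norm (x - f x)))"
      using assms(2) by (simp add: s_def)
    also have "\<dots> \<le> R"
      using assms(2) by (intro mult_left_le) (auto simp: divide_le_eq_1 less_max_iff_disj)
    finally show ?thesis .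
  qed
  then have "(\<lambda>x. s x *\<^sub>R (x - f x)) \<in> cball 0 R \<rightarrow> cball 0 R"
    by auto
  ultimately obtain x where x: "s x *\<^sub>R (x - f x) = x"
    using brouwer[of "cball 0 R" "\<lambda>x. s x *\<^sub>R (x - f x)"] assms(2) by force
  \<comment> \<open>The fixed point equation says that \<open>f x\<close> is
    \<open>- ((1 - s x) / s x)\<close> times \<open>x\<close>.\<close>
  define \<mu> where "\<mu> = (1 - s x) / s x"
  show ?thesis
  proof
    show "\<mu> \<ge> 0"
      using s[of x] by (simp add: \<mu>_def)
    have "s x * \<mu> = 1 - s x"
      using s[of x] by (simp add: \<mu>_def)
    then have "s x *\<^sub>R (f x + \<mu> *\<^sub>R x) = x - s x *\<^sub>R (x - f x)"
      by (simp add: scaleR_add_right scaleR_diff_right scaleR_diff_left)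
    then show "f x + \<mu> *\<^sub>R x = 0"
      using x s[of x] by simp
    \<comment> \<open>Either the projection leaves \<open>x - f x\<close> unchanged and the fixed
      point is a zero, or its image, which is \<open>x\<close>, lies on the sphere.\<close>
    show "f x = 0 \<or> norm x = R"
    proof (cases "norm (x - f x) \<le> R")
      case True
      then have "s x = 1"
        using assms(2) by (simp add: s_def)
      then show ?thesis
        using x by simp
    next
      case False
      then have "norm (x - f x) > 0" "max R (norm (x - f x)) = norm (x - f x)"
        using assms(2) by auto
      then have "norm (s x *\<^sub>R (x - f x)) = R"
        using assms(2) by (simp add: s_def)
      then show ?thesis
        using x by simp
    qed
  qed
qed

section \<open>Exclusion of multiplier sequences at infinity\<close>

text \<open>
  The multiplier may become unbounded; \<open>p\<close> and \<open>q\<close> below play the role of \<open>1 / (1 + v)\<close> and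
  \<open>1 / (1 + t)\<close> for the parameters \<open>v, t \<in> [0, \<infinity>]\<close> of an ER pair.
\<close>

lemma ER_pair_no_compactified_solution:
  assumes ER: "ER_tensor_pair m A l B"
    and pd: "m = l \<or> positive_definite_tensor m A"
    and p: "0 \<le> p" "p \<le> 1" and q: "0 \<le> q" "q \<le> p" "m = l \<Longrightarrow> q = p"
    and c: "complementary (p *\<^sub>R tensor_apply m A u + (1 - p) *\<^sub>R u)
                          (q *\<^sub>R tensor_apply l B u + (1 - q) *\<^sub>R u)"
  shows "u = 0"
proof (rule ccontr)
  assume u: "u \<noteq> 0"
  consider "q > 0" | "q = 0" "p > 0" | "q = 0" "p = 0"
    using p q by linarith
  then show False
  proof cases
    \<comment> \<open>Both multipliers are finite: \<open>v = (1 - p) / p\<close> and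
      \<open>t = (1 - q) / q\<close> violate the ER property.\<close>
    case 1
    with q have "p > 0"
      by simp
    have "complementary (tensor_apply m A u + ((1 - p) / p) *\<^sub>R u)
                        (tensor_apply l B u + ((1 - q) / q) *\<^sub>R u)"
      using complementary_scaleR[OF c, of "inverse p" "inverse q"] 1 \<open>p > 0\<close>
      by (simp add: scaleR_add_right divide_inverse mult.commute)
    moreover have "(1 - p) / p \<ge> 0" "(1 - q) / q \<ge> 0"
      using p q by auto
    ultimately show False
      using ER u unfolding ER_tensor_pair_def by blast
  next
    \<comment> \<open>The second vector is \<open>u\<close> itself, so complementarity tests the
      first one against \<open>u\<close>. As \<open>q\<close> differs from \<open>p\<close>, the
      orders differ and \<open>A\<close> is positive definite.\<close>
    case 2
    with c have "u \<bullet> (p *\<^sub>R tensor_apply m A u + (1 - p) *\<^sub>R u) = 0"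
      by (simp add: complementary_def inner_commute)
    then have "p * tensor_form m A u + (1 - p) * (u \<bullet> u) = 0"
      by (simp add: tensor_form_def inner_add_right)
    moreover have "tensor_form m A u > 0"
      using pd q(3) 2 u by (auto simp: positive_definite_tensor_def)
    then have "p * tensor_form m A u > 0"
      using 2 by simp
    moreover have "(1 - p) * (u \<bullet> u) \<ge> 0"
      using p by simp
    ultimately show False
      by linarith
  next
    case 3
    with c u show False
      by (simp add: complementary_def)
  qed
qed

text \<open>
  With \<open>e\<close> the perturbed residual, scaling \<open>F x + \<mu> x - e\<close> by \<open>1 / (r\<^bsup>m-1\<^esup> (1 + v))\<close> with
  \<open>r = norm x\<close> and \<open>v = \<mu> / r\<^bsup>m-2\<^esup>\<close>, and similarly the other map, keeps all quantities bounded.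
\<close>

lemma no_multiplier_sequence_at_infinity:
  fixes x e :: "nat \<Rightarrow> real ^ 'n::finite"
  assumes "l \<ge> 2" "l \<le> m"
    and ER: "ER_tensor_pair m (\<A> 1) l (\<B> 1)"
    and pd: "m = l \<or> positive_definite_tensor m (\<A> 1)"
    and x: "filterlim (\<lambda>k. norm (x k)) at_top sequentially"
    and \<mu>: "\<And>k. \<mu> k \<ge> 0"
    and e: "(\<lambda>k. e k /\<^sub>R norm (x k)) \<longlonglongrightarrow> 0"
    and eq: "\<And>k. (\<chi> j. min (tensor_poly m \<A> a (x k) $ j) (tensor_poly l \<B> b (x k) $ j))
                   + \<mu> k *\<^sub>R x k = e k"
  shows False
proof -
  \<comment> \<open>Initial terms are dropped to have \<open>r k \<ge> 1\<close>: then
    \<open>l \<le> m\<close> makes the power of \<open>r k\<close> in \<open>p k\<close> the larger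
    one, whence \<open>q k \<le> p k\<close>.\<close>
  have "eventually (\<lambda>k. norm (x k) \<ge> 1) sequentially"
    using x by (simp add: filterlim_at_top)
  then obtain N where N: "\<And>k. k \<ge> N \<Longrightarrow> norm (x k) \<ge> 1"
    by (auto simp: eventually_sequentially)
  define r where "r k = norm (x (k + N))" for k
  define u where "u k = x (k + N) /\<^sub>R r k" for k
  define p where "p k = inverse (1 + \<mu> (k + N) / r k ^ (m - 2))" for k
  define q where "q k = inverse (1 + \<mu> (k + N) / r k ^ (l - 2))" for k
  have r1: "r k \<ge> 1" for k
    unfolding r_def by (rule N) simp
  have r0: "r k > 0" for k
    using r1[of k] by linarith
  have xu: "x (k + N) = r k *\<^sub>R u k" for k
    using r0[of k] by (simp add: u_def)
  have nu: "norm (u k) = 1" for k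
    using r0[of k] by (simp add: u_def r_def)
  have pq: "0 < q k" "q k \<le> p k" "p k \<le> 1" for k
  proof -
    have v: "0 \<le> \<mu> (k + N) / r k ^ (m - 2)"
      using \<mu> r0[of k] by simp
    have "\<mu> (k + N) / r k ^ (m - 2) \<le> \<mu> (k + N) / r k ^ (l - 2)"
      using \<mu> r0[of k] r1[of k] assms(2)
      by (intro divide_left_mono power_increasing mult_pos_pos zero_less_power) auto
    with v show "q k \<le> p k" "p k \<le> 1" "0 < q k"
      unfolding p_def q_def
      by (auto intro!: le_imp_inverse_le inverse_le_1_iff[THEN iffD2] add_pos_nonneg)
  qed
  \<comment> \<open>One subsequence serves the directions and both weights. A weight may tend to 0,
    which stands for an infinite multiplier.\<close>
  have "(u k, p k, q k) \<in> sphere 0 1 \<times> {0..1} \<times> {0..1}" for k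
    using pq[of k] nu[of k] by auto
  moreover have "compact (sphere (0 :: real ^ 'n) 1 \<times> {0..1 :: real} \<times> {0..1 :: real})"
    by (intro compact_Times compact_Icc compact_sphere)
  ultimately obtain w \<phi> where w: "w \<in> sphere 0 1 \<times> {0..1} \<times> {0..1}" 
    and \<phi>: "strict_mono \<phi>" and lim: "((\<lambda>k. (u k, p k, q k)) \<circ> \<phi>) \<longlonglongrightarrow> w"
    unfolding compact_def by meson
  obtain u0 p0 q0 where w_eq: "w = (u0, p0, q0)"
    by (metis prod.exhaust)
  have ulim: "(\<lambda>k. u (\<phi> k)) \<longlonglongrightarrow> u0" and plim: "(\<lambda>k. p (\<phi> k)) \<longlonglongrightarrow> p0"
    and qlim: "(\<lambda>k. q (\<phi> k)) \<longlonglongrightarrow> q0"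
    using tendsto_fst[OF lim] tendsto_fst[OF tendsto_snd[OF lim]] tendsto_snd[OF tendsto_snd[OF lim]]
    by (simp_all add: w_eq o_def)
  have shift: "filterlim (\<lambda>k. \<phi> k + N) at_top sequentially"
    by (rule filterlim_compose[OF filterlim_add_const_nat_at_top filterlim_subseq[OF \<phi>]])
  have rlim: "filterlim (\<lambda>k. r (\<phi> k)) at_top sequentially"
    unfolding r_def by (rule filterlim_compose[OF x shift])
  have elim: "(\<lambda>k. e (\<phi> k + N) /\<^sub>R r (\<phi> k)) \<longlonglongrightarrow> 0"
    unfolding r_def by (rule filterlim_compose[OF e shift])
  \<comment> \<open>Stated for a generic order so as to serve both maps. For \<open>d = 2\<close>
    the coefficient of the error term need not vanish in the limit; the term does by the assumption
    on \<open>e\<close>.\<close>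
  have scaled: "(\<lambda>k. \<rho> (\<phi> k) *\<^sub>R (inverse (r (\<phi> k) ^ (d - 1)) *\<^sub>R tensor_poly d \<C> c (r (\<phi> k) *\<^sub>R u (\<phi> k)))
         + (1 - \<rho> (\<phi> k)) *\<^sub>R u (\<phi> k)
         - (\<rho> (\<phi> k) * inverse (r (\<phi> k)) ^ (d - 2)) *\<^sub>R (e (\<phi> k + N) /\<^sub>R r (\<phi> k)))
       \<longlonglongrightarrow> \<rho>0 *\<^sub>R tensor_apply d (\<C> 1) u0 + (1 - \<rho>0) *\<^sub>R u0"
    if "d \<ge> 2" "(\<lambda>k. \<rho> (\<phi> k)) \<longlonglongrightarrow> \<rho>0" for d \<C> c \<rho> \<rho>0
  proof -
    have "(\<lambda>k. \<rho> (\<phi> k) *\<^sub>R (inverse (r (\<phi> k) ^ (d - 1)) *\<^sub>R tensor_poly d \<C> c (r (\<phi> k) *\<^sub>R u (\<phi> k)))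
         + (1 - \<rho> (\<phi> k)) *\<^sub>R u (\<phi> k)
         - (\<rho> (\<phi> k) * inverse (r (\<phi> k)) ^ (d - 2)) *\<^sub>R (e (\<phi> k + N) /\<^sub>R r (\<phi> k)))
       \<longlonglongrightarrow> \<rho>0 *\<^sub>R tensor_apply d (\<C> 1) u0 + (1 - \<rho>0) *\<^sub>R u0 - (\<rho>0 * 0 ^ (d - 2)) *\<^sub>R 0"
      using that r0
      by (intro tendsto_intros tensor_poly_leading_term ulim rlim elim tendsto_inverse_0_at_top) auto
    then show ?thesis
      by simp
  qed
  \<comment> \<open>The choice of \<open>\<rho>\<close> gives
    \<open>1 - \<rho> = \<rho> * \<mu> / r ^ (d - 2)\<close>, so the convex weight on
    \<open>u k\<close> is exactly the rescaled multiplier term.\<close>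
  have norm_form: "\<rho> *\<^sub>R (inverse (r k ^ (d - 1)) *\<^sub>R y) + (1 - \<rho>) *\<^sub>R u k
         - (\<rho> * inverse (r k) ^ (d - 2)) *\<^sub>R (e (k + N) /\<^sub>R r k)
       = (\<rho> * inverse (r k ^ (d - 1))) *\<^sub>R (y + \<mu> (k + N) *\<^sub>R x (k + N) - e (k + N))"
    if "d \<ge> 2" "\<rho> = inverse (1 + \<mu> (k + N) / r k ^ (d - 2))" for d \<rho> y k
  proof -
    have "r k ^ (d - 1) = r k * r k ^ (d - 2)"
      using that(1) by (metis Suc_diff_Suc Suc_1 Suc_le_lessD power_Suc)
    moreover have "1 + \<mu> (k + N) / r k ^ (d - 2) > 0"
      using \<mu> r0[of k] by (intro add_pos_nonneg) auto
    then have "1 - \<rho> = \<rho> * (\<mu> (k + N) / r k ^ (d - 2))"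
      by (simp add: that(2) field_simps)
    ultimately have "1 - \<rho> = \<rho> * inverse (r k ^ (d - 1)) * \<mu> (k + N) * r k"
      and "inverse (r k) ^ (d - 2) * inverse (r k) = inverse (r k ^ (d - 1))"
      using r0[of k] by (simp_all add: field_simps)
    then show ?thesis
      by (simp add: xu scaleR_add_right scaleR_diff_right mult.assoc)
  qed
  have "complementary (p0 *\<^sub>R tensor_apply m (\<A> 1) u0 + (1 - p0) *\<^sub>R u0)
                      (q0 *\<^sub>R tensor_apply l (\<B> 1) u0 + (1 - q0) *\<^sub>R u0)"
  proof (rule complementary_tendsto[OF scaled[OF _ plim] scaled[OF _ qlim]])
    show "m \<ge> 2" "l \<ge> 2"
      using assms by auto
    show "eventually (\<lambda>k. complementary
        (p (\<phi> k) *\<^sub>R (inverse (r (\<phi> k) ^ (m - 1)) *\<^sub>R tensor_poly m \<A> a (r (\<phi> k) *\<^sub>R u (\<phi> k)))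
         + (1 - p (\<phi> k)) *\<^sub>R u (\<phi> k)
         - (p (\<phi> k) * inverse (r (\<phi> k)) ^ (m - 2)) *\<^sub>R (e (\<phi> k + N) /\<^sub>R r (\<phi> k)))
        (q (\<phi> k) *\<^sub>R (inverse (r (\<phi> k) ^ (l - 1)) *\<^sub>R tensor_poly l \<B> b (r (\<phi> k) *\<^sub>R u (\<phi> k)))
         + (1 - q (\<phi> k)) *\<^sub>R u (\<phi> k)
         - (q (\<phi> k) * inverse (r (\<phi> k)) ^ (l - 2)) *\<^sub>R (e (\<phi> k + N) /\<^sub>R r (\<phi> k)))) sequentially"
    proof (intro always_eventually allI)
      fix k
      let ?k = "\<phi> k + N"
      \<comment> \<open>Adding the same vector to both arguments shifts \<open>min\<close> by that
        vector, so \<open>eq\<close> says that the shifted pair has minimum 0.\<close>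
      have "complementary (tensor_poly m \<A> a (x ?k) + \<mu> ?k *\<^sub>R x ?k - e ?k)
                          (tensor_poly l \<B> b (x ?k) + \<mu> ?k *\<^sub>R x ?k - e ?k)"
        using eq[of ?k] by (auto simp: complementary_iff_min vec_eq_iff min_def split: if_splits)
      then have "complementary
          ((p (\<phi> k) * inverse (r (\<phi> k) ^ (m - 1))) *\<^sub>R (tensor_poly m \<A> a (x ?k) + \<mu> ?k *\<^sub>R x ?k - e ?k))
          ((q (\<phi> k) * inverse (r (\<phi> k) ^ (l - 1))) *\<^sub>R (tensor_poly l \<B> b (x ?k) + \<mu> ?k *\<^sub>R x ?k - e ?k))"
        using pq[of "\<phi> k"] r0[of "\<phi> k"] by (intro complementary_scaleR) auto
      then show "complementary
        (p (\<phi> k) *\<^sub>R (inverse (r (\<phi> k) ^ (m - 1)) *\<^sub>R tensor_poly m \<A> a (r (\<phi> k) *\<^sub>R u (\<phi> k)))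
         + (1 - p (\<phi> k)) *\<^sub>R u (\<phi> k)
         - (p (\<phi> k) * inverse (r (\<phi> k)) ^ (m - 2)) *\<^sub>R (e ?k /\<^sub>R r (\<phi> k)))
        (q (\<phi> k) *\<^sub>R (inverse (r (\<phi> k) ^ (l - 1)) *\<^sub>R tensor_poly l \<B> b (r (\<phi> k) *\<^sub>R u (\<phi> k)))
         + (1 - q (\<phi> k)) *\<^sub>R u (\<phi> k)
         - (q (\<phi> k) * inverse (r (\<phi> k)) ^ (l - 2)) *\<^sub>R (e ?k /\<^sub>R r (\<phi> k)))"
        using norm_form[OF _ p_def[of "\<phi> k"]] norm_form[OF _ q_def[of "\<phi> k"]] assms(1,2)
        by (simp only: xu[symmetric])
    qed
  qed simp
  moreover have "q0 \<le> p0"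
    using pq(2) by (intro LIMSEQ_le[OF qlim plim]) auto
  \<comment> \<open>For equal orders the two weights are the same sequence; this excludes the mixed
    case, in which positive definiteness would be required.\<close>
  moreover have "q0 = p0" if "m = l"
    using that plim qlim by (simp add: p_def q_def LIMSEQ_unique)
  ultimately have "u0 = 0"
    using w by (intro ER_pair_no_compactified_solution[OF ER pd, of p0 q0]) (auto simp: w_eq)
  then show False
    using w by (simp add: w_eq)
qed

section \<open>Existence of solutions and the global error bound\<close>

theorem theorem5p5:
  fixes m l :: nat
    and \<A> \<B> :: "nat \<Rightarrow> 'n::finite tensor"
    and a b :: "real ^ 'n"
    and F G :: "real ^ 'n \<Rightarrow> real ^ 'n"
    and \<Omega> :: "(real ^ 'n) set"
  assumes "CARD('n) \<ge> 2" and "m \<ge> 2" and "l \<ge> 2"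
    and "\<A> \<in> tensor_tuples m" and "\<B> \<in> tensor_tuples l"
    and "ER_tensor_pair m (\<A> 1) l (\<B> 1)"
    and "m = l
         \<or> l < m \<and> positive_definite_tensor m (\<A> 1)
         \<or> m < l \<and> positive_definite_tensor l (\<B> 1)"
    and "F = tensor_poly m \<A> a" and "G = tensor_poly l \<B> b"
    and "\<Omega> = GPCP_solutions F G"
    and "\<And>(xs :: nat \<Rightarrow> real ^ 'n) xbar.
           xs \<longlonglongrightarrow> xbar \<Longrightarrow> xbar \<in> \<Omega> \<Longrightarrow> (\<And>i. xs i \<noteq> xbar) \<Longrightarrow>
           \<exists>\<phi> :: nat \<Rightarrow> nat. strict_mono \<phi> \<and>
             (\<exists>j0. \<not> (\<lambda>j. min (F (xs (\<phi> j)) $ j0) (G (xs (\<phi> j)) $ j0)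
                              / norm (xs (\<phi> j) - xbar)) \<longlonglongrightarrow> 0)"
  shows "global_Lipschitz_error_bound (natural_residual F G) \<Omega>"
proof -
  note cond = assms(11)
  define f where "f x = (\<chi> j. min (F x $ j) (G x $ j))" for x
  have f_commute: "f x = (\<chi> j. min (G x $ j) (F x $ j))" for x
    by (simp add: f_def min.commute)
  have ER': "ER_tensor_pair l (\<B> 1) m (\<A> 1)"
    using assms(6) unfolding ER_tensor_pair_def by (subst complementary_commute) blast
  have f_cont: "continuous_on UNIV f"
    unfolding f_def assms(8,9)
    by (intro continuous_intros continuous_on_tensor_poly)
  have \<Omega>_iff: "x \<in> \<Omega> \<longleftrightarrow> f x = 0" for x
    by (simp add: assms(10) GPCP_solutions_def complementary_iff_min f_def vec_eq_iff)
  have res: "natural_residual F G x = norm (f x)" for x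
    by (simp add: natural_residual_def f_def)
  \<comment> \<open>The map of larger order has to come first; for \<open>m < l\<close> the two maps
    exchange roles, which leaves \<open>f\<close> unchanged.\<close>
  have no_seq: False
    if "filterlim (\<lambda>k. norm (x k)) at_top sequentially" "\<And>k. \<mu> k \<ge> 0"
      "(\<lambda>k. e k /\<^sub>R norm (x k)) \<longlonglongrightarrow> 0" "\<And>k. f (x k) + \<mu> k *\<^sub>R x k = e k"
    for x e :: "nat \<Rightarrow> real ^ 'n" and \<mu> :: "nat \<Rightarrow> real"
  proof (cases "l \<le> m")
    case True
    then show False
      using that assms(7) unfolding f_def assms(8,9)
      by (intro no_multiplier_sequence_at_infinity[where \<A> = \<A> and \<B> = \<B>, OF assms(3) True assms(6), of x \<mu> e]) auto
  next
    case False
    then show False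
      using that assms(7) unfolding f_commute assms(8,9)
      by (intro no_multiplier_sequence_at_infinity[where \<A> = \<B> and \<B> = \<A>, OF assms(2) _ ER', of x \<mu> e]) auto
  qed
  have "\<Omega> \<noteq> {}"
  proof
    assume empty: "\<Omega> = {}"
    \<comment> \<open>Without zeros of \<open>f\<close>, Brouwer's alternative puts a point with a
      multiplier on every sphere; the radii \<open>Suc k\<close> are positive and unbounded.\<close>
    have "\<exists>x \<mu>. \<mu> \<ge> 0 \<and> f x + \<mu> *\<^sub>R x = 0 \<and> norm x = real (Suc k)" for k
      using Brouwer_zero_or_multiplier[OF f_cont, of "real (Suc k)"] \<Omega>_iff empty
      by (metis empty_iff of_nat_0_less_iff zero_less_Suc)
    then obtain x \<mu> where x: "\<And>k. \<mu> k \<ge> 0" "\<And>k. f (x k) + \<mu> k *\<^sub>R x k = 0"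
      "\<And>k. norm (x k) = real (Suc k)"
      by metis
    have "filterlim (\<lambda>k. norm (x k)) at_top sequentially"
      unfolding x(3) by (rule filterlim_compose[OF filterlim_real_sequentially filterlim_Suc])
    then show False
      using no_seq[of x \<mu> "\<lambda>_. 0"] x by simp
  qed
  then obtain \<omega> where \<omega>: "\<omega> \<in> \<Omega>"
    by blast
  have "\<exists>c>0. \<forall>x. infdist x \<Omega> \<le> c * norm (f x)"
  proof (rule ccontr)
    assume "\<not> ?thesis"
    then have "\<exists>x. infdist x \<Omega> > real (Suc k) * norm (f x)" for k
      by (metis not_le of_nat_0_less_iff zero_less_Suc)
    then obtain x where x: "\<And>k. infdist (x k) \<Omega> > real (Suc k) * norm (f (x k))"
      by metis
    \<comment> \<open>The distance to \<open>\<Omega>\<close> is at most that to any single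
      solution. This is used for the fixed solution \<open>\<omega>\<close> and later for a limit
      point.\<close>
    have small: "norm (f (x k)) \<le> dist (x k) y * inverse (real (Suc k))" if "y \<in> \<Omega>" for k y
    proof -
      have "real (Suc k) * norm (f (x k)) \<le> dist (x k) y"
        using x[of k] infdist_le[OF that, of "x k"] by linarith
      then show ?thesis
        by (simp add: field_simps)
    qed
    have inv: "(\<lambda>k. inverse (real (Suc k))) \<longlonglongrightarrow> 0"
      by (rule LIMSEQ_inverse_real_of_nat)
    show False
    proof (cases "filterlim (\<lambda>k. norm (x k)) at_top sequentially")
      case True
      \<comment> \<open>Since \<open>dist (x k) \<omega>\<close> is at most a constant times
        \<open>norm (x k)\<close>, the residual is of smaller order than \<open>norm (x k)\<close>;
        \<open>no_seq\<close> then applies with multiplier 0.\<close>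
      have "(\<lambda>k. f (x k) /\<^sub>R norm (x k)) \<longlonglongrightarrow> 0"
      proof (rule Lim_null_comparison)
        show "(\<lambda>k. (1 + norm \<omega>) * inverse (real (Suc k))) \<longlonglongrightarrow> 0"
          using tendsto_mult[OF tendsto_const inv] by simp
        have "eventually (\<lambda>k. norm (x k) \<ge> 1) sequentially"
          using True by (simp add: filterlim_at_top)
        then show "eventually (\<lambda>k. norm (f (x k) /\<^sub>R norm (x k))
            \<le> (1 + norm \<omega>) * inverse (real (Suc k))) sequentially"
        proof eventually_elim
          case (elim k)
          have "dist (x k) \<omega> \<le> norm (x k) + norm \<omega>"
            by (simp add: dist_norm norm_triangle_ineq4)
          also have "\<dots> \<le> norm (x k) + norm \<omega> * norm (x k)"
            using elim by (simp add: mult_left_le mult_le_cancel_left1)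
          finally have "dist (x k) \<omega> \<le> (1 + norm \<omega>) * norm (x k)"
            by (simp add: algebra_simps)
          then have "dist (x k) \<omega> * inverse (real (Suc k))
              \<le> (1 + norm \<omega>) * norm (x k) * inverse (real (Suc k))"
            by (rule mult_right_mono) simp
          with small[OF \<omega>, of k]
          have "norm (f (x k)) \<le> (1 + norm \<omega>) * inverse (real (Suc k)) * norm (x k)"
            by (simp only: mult_ac)
          then have "norm (f (x k)) / norm (x k) \<le> (1 + norm \<omega>) * inverse (real (Suc k))"
            using elim by (subst pos_divide_le_eq) auto
          then show ?case
            by (simp add: divide_inverse mult.commute)
        qed
      qed
      then show False
        using no_seq[OF True, of "\<lambda>_. 0" "\<lambda>k. f (x k)"] by simp
    next
      case False
      \<comment> \<open>Norms that do not tend to infinity stay below some \<open>Z\<close>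
        infinitely often; enumerating these indices gives a bounded subsequence.\<close>
      then obtain Z where Z: "\<exists>\<^sub>F k in sequentially. norm (x k) \<le> Z"
        unfolding filterlim_at_top_dense frequently_def by (auto simp: not_le)
      then have inf: "infinite {k. norm (x k) \<le> Z}"
        by (simp add: frequently_cofinite flip: cofinite_eq_sequentially)
      define \<sigma> where "\<sigma> = enumerate {k. norm (x k) \<le> Z}"
      have \<sigma>: "strict_mono \<sigma>" "\<And>k. norm (x (\<sigma> k)) \<le> Z"
        using inf enumerate_in_set[OF inf] by (auto simp: \<sigma>_def strict_mono_enumerate)
      then have "\<And>k. (x \<circ> \<sigma>) k \<in> cball 0 Z"
        by simp
      then obtain y \<phi> where \<phi>: "strict_mono \<phi>" and y: "((x \<circ> \<sigma>) \<circ> \<phi>) \<longlonglongrightarrow> y"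
        using compact_cball unfolding compact_def by meson
      define z where "z = x \<circ> \<sigma> \<circ> \<phi>"
      have \<psi>: "strict_mono (\<sigma> \<circ> \<phi>)"
        using \<sigma> \<phi> by (simp add: strict_mono_o)
      have zlim: "z \<longlonglongrightarrow> y"
        using y by (simp add: z_def)
      \<comment> \<open>The bound survives reindexing because
        \<open>\<sigma> (\<phi> k) \<ge> k\<close>.\<close>
      have z_small: "norm (f (z k)) \<le> dist (z k) w * inverse (real (Suc k))" if "w \<in> \<Omega>" for k w
      proof -
        have "k \<le> \<sigma> (\<phi> k)"
          using seq_suble[OF \<psi>, of k] by simp
        then have "inverse (real (Suc (\<sigma> (\<phi> k)))) \<le> inverse (real (Suc k))"
          by (intro le_imp_inverse_le) auto
        then have "dist (z k) w * inverse (real (Suc (\<sigma> (\<phi> k)))) \<le> dist (z k) w * inverse (real (Suc k))"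
          by (rule mult_left_mono) simp
        then show ?thesis
          using small[OF that, of "\<sigma> (\<phi> k)"] by (simp add: z_def)
      qed
      have "(\<lambda>k. norm (f (z k))) \<longlonglongrightarrow> norm (f y)"
        using f_cont zlim by (intro tendsto_norm) (auto simp: continuous_on_eq_continuous_at isCont_tendsto_compose)
      moreover have "(\<lambda>k. norm (f (z k))) \<longlonglongrightarrow> 0"
      proof (rule tendsto_sandwich[OF _ _ tendsto_const])
        show "(\<lambda>k. dist (z k) \<omega> * inverse (real (Suc k))) \<longlonglongrightarrow> 0"
          using tendsto_mult[OF tendsto_dist[OF zlim tendsto_const] inv] by simp
      qed (use z_small[OF \<omega>] in auto)
      ultimately have "norm (f y) = 0"
        by (rule LIMSEQ_unique)
      then have y\<Omega>: "y \<in> \<Omega>"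
        by (simp add: \<Omega>_iff)
      \<comment> \<open>The chosen points violate the bound strictly, so their distance to
        \<open>\<Omega>\<close> is positive and none of them is a solution.\<close>
      have ne: "z k \<noteq> y" for k
      proof
        assume "z k = y"
        then have "infdist (x (\<sigma> (\<phi> k))) \<Omega> = 0"
          using y\<Omega> by (simp add: z_def)
        then show False
          using x[of "\<sigma> (\<phi> k)"] by (smt (verit) mult_nonneg_nonneg norm_ge_zero of_nat_0_le_iff)
      qed
      obtain \<theta> j0 where \<theta>: "strict_mono \<theta>" and
        not: "\<not> (\<lambda>j. min (F (z (\<theta> j)) $ j0) (G (z (\<theta> j)) $ j0) / norm (z (\<theta> j) - y)) \<longlonglongrightarrow> 0"
        using cond[OF zlim y\<Omega> ne] by blast
      \<comment> \<open>With \<open>w = y\<close>, \<open>z_small\<close> bounds the quotient by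
        \<open>inverse (real (Suc k))\<close> in every component, so no subsequence can avoid the
        limit 0.\<close>
      have "(\<lambda>k. f (z k) $ j0 / norm (z k - y)) \<longlonglongrightarrow> 0"
      proof (rule Lim_null_comparison[OF always_eventually inv], rule allI)
        fix k
        have "\<bar>f (z k) $ j0\<bar> \<le> inverse (real (Suc k)) * norm (z k - y)"
          using component_le_norm_cart[of "f (z k)" j0] z_small[OF y\<Omega>, of k]
          by (simp add: dist_norm mult.commute)
        then show "norm (f (z k) $ j0 / norm (z k - y)) \<le> inverse (real (Suc k))"
          using ne[of k] by (simp add: pos_divide_le_eq)
      qed
      from LIMSEQ_subseq_LIMSEQ[OF this \<theta>] not show False
        by (simp add: f_def o_def)
    qed
  qed
  then show ?thesis
    using \<open>\<Omega> \<noteq> {}\<close> by (simp add: global_Lipschitz_error_bound_def res)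
qed

end
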